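(* Let $P_t:\Sigma\to\mathbf{R}^3_1$, $0\le t\le1$, be a nontrivial flex of a closed (compact, without boundary) orientable polyhedron in the Minkowski 3-space. Then the generalized volume $\mathrm{Vol}\,P_t$ is independent of $t$.
   Context: $\mathbf{R}^3_1$ is $\mathbf{R}^3$ with scalar product $(x,y)=x_1y_1+x_2y_2-x_3y_3$ and length $|x|=\sqrt{(x,x)}$. A polyhedron is a continuous map $P:\Sigma\to\mathbf{R}^3_1$, $\Sigma$ a connected 2-dimensional simplicial complex that is a manifold, affine and injective on each simplex. A nontrivial flex of $P$ is a family of polyhedra $P_t:\Sigma\to\mathbf{R}^3_1$, analytic in $t\in[0,1]$, with $P_0=P$, every edge length $|P_t(v)-P_t(w)|$ ($vw$ an edge of $\Sigma$) independent of $t$, and some pair of vertices whose Minkowski distance is nonconstant in $t$. The volume of a domain in $\mathbf{R}^3_1$ is its Euclidean volume as a subset of $\mathbf{R}^3$. For a closed oriented polyhedron $P$ and any point $p_*$, the generalized volume is $\mathrm{Vol}\,P=\sum_\Delta\varepsilon(p_*,\Delta)\,\mathrm{vol}[p_*,\Delta]$, the sum over all positively oriented 2-simplices $\Delta$ of $P$, where $[p_*,\Delta]$ is the tetrahedron spanned by $p_*$ and $P(\Delta)$ with orientation induced from $\Delta$, and $\varepsilon(p_*,\Delta)=+1$ or $-1$ according as this orientation agrees or disagrees with that of the space (equivalently, $\mathrm{Vol}\,P=\frac16\sum\det(P(a),P(b),P(c))$ over positively oriented triangles $(a,b,c)$; it is independent of $p_*$). *)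

theory Defs
  imports "HOL-Analysis.Analysis"
begin

text \<open>Minkowski 3-space: real^3 with scalar product x1 y1 + x2 y2 - x3 y3.\<close>

definition mink :: "real^3 \<Rightarrow> real^3 \<Rightarrow> real" where
  "mink x y = x$1 * y$1 + x$2 * y$2 - x$3 * y$3"

text \<open>Length |x| = sqrt((x,x)), a complex number in general (imaginary for timelike x).\<close>
definition mlength :: "real^3 \<Rightarrow> complex" where
  "mlength x = csqrt (complex_of_real (mink x x))"

text \<open>Combinatorial surface: a set T of positively oriented triangles (a,b,c).
  A triple is "in T up to cyclic rotation".\<close>
definition intri :: "('v \<times> 'v \<times> 'v) set \<Rightarrow> 'v \<Rightarrow> 'v \<Rightarrow> 'v \<Rightarrow> bool" where
  "intri T a b c \<longleftrightarrow> (a,b,c) \<in> T \<or> (b,c,a) \<in> T \<or> (c,a,b) \<in> T"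

definition tri_verts :: "'v \<times> 'v \<times> 'v \<Rightarrow> 'v set" where
  "tri_verts t = (case t of (a,b,c) \<Rightarrow> {a,b,c})"

definition darts :: "'v \<times> 'v \<times> 'v \<Rightarrow> ('v \<times> 'v) set" where
  "darts t = (case t of (a,b,c) \<Rightarrow> {(a,b),(b,c),(c,a)})"

definition vertices :: "('v \<times> 'v \<times> 'v) set \<Rightarrow> 'v set" where
  "vertices T = (\<Union>t\<in>T. tri_verts t)"

definition edge_rel :: "('v \<times> 'v \<times> 'v) set \<Rightarrow> 'v rel" where
  "edge_rel T = (\<Union>t\<in>T. darts t)"

text \<open>Link of vertex v as a (cyclic) successor relation on the link vertices.\<close>
definition link_rel :: "('v \<times> 'v \<times> 'v) set \<Rightarrow> 'v \<Rightarrow> 'v rel" where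
  "link_rel T v = {(a,b). intri T v a b}"

text \<open>T is a coherently oriented triangulation of a connected closed (compact, without
  boundary) orientable surface: finite, nonempty; each triangle has three distinct vertices;
  distinct triangles have distinct vertex sets (simplicial complex, each 2-simplex listed once);
  every directed edge occurring lies in exactly one triangle and its reverse in exactly one
  triangle (closed, coherently oriented); every vertex link is a single cycle (manifold);
  the 1-skeleton is connected.\<close>
definition oriented_closed_surface :: "('v \<times> 'v \<times> 'v) set \<Rightarrow> bool" where
  "oriented_closed_surface T \<longleftrightarrow>
     finite T \<and> T \<noteq> {} \<and>
     (\<forall>(a,b,c)\<in>T. a \<noteq> b \<and> b \<noteq> c \<and> a \<noteq> c) \<and>
     (\<forall>s\<in>T. \<forall>t\<in>T. tri_verts s = tri_verts t \<longrightarrow> s = t) \<and>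
     (\<forall>(x,y)\<in>edge_rel T. (\<exists>!t. t \<in> T \<and> (x,y) \<in> darts t) \<and>
                          (\<exists>!t. t \<in> T \<and> (y,x) \<in> darts t)) \<and>
     (\<forall>v\<in>vertices T. \<forall>a\<in>Domain (link_rel T v). \<forall>b\<in>Domain (link_rel T v).
          (a,b) \<in> (link_rel T v)\<^sup>+) \<and>
     (\<forall>x\<in>vertices T. \<forall>y\<in>vertices T. (x,y) \<in> (edge_rel T)\<^sup>*)"

text \<open>A polyhedron: vertex map, affine on each triangle (determined by vertex images),
  injective on each simplex, i.e. the three image vertices are affinely independent.\<close>
definition polyhedron :: "('v \<times> 'v \<times> 'v) set \<Rightarrow> ('v \<Rightarrow> real^3) \<Rightarrow> bool" where
  "polyhedron T P \<longleftrightarrow> (\<forall>(a,b,c)\<in>T. P a \<noteq> P b \<and> P b \<noteq> P c \<and> P a \<noteq> P c \<and>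
                                     \<not> affine_dependent {P a, P b, P c})"

text \<open>Generalized volume: (1/6) * sum of det(P a, P b, P c) over positively oriented triangles.\<close>
definition gen_vol :: "('v \<times> 'v \<times> 'v) set \<Rightarrow> ('v \<Rightarrow> real^3) \<Rightarrow> real" where
  "gen_vol T P = (1/6) * (\<Sum>(a,b,c)\<in>T. det (vector [P a, P b, P c] :: real^3^3))"

text \<open>Real analyticity on a set S: locally (within S) the sum of a convergent power series.\<close>
definition real_analytic_on :: "(real \<Rightarrow> real) \<Rightarrow> real set \<Rightarrow> bool" where
  "real_analytic_on f S \<longleftrightarrow>
     (\<forall>x\<in>S. \<exists>r>0. \<exists>c::nat \<Rightarrow> real. \<forall>y\<in>S. \<bar>y - x\<bar> < r \<longrightarrow> (\<lambda>n. c n * (y - x)^n) sums f y)"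

text \<open>Nontrivial flex on [0,1].\<close>
definition nontrivial_flex :: "('v \<times> 'v \<times> 'v) set \<Rightarrow> (real \<Rightarrow> 'v \<Rightarrow> real^3) \<Rightarrow> bool" where
  "nontrivial_flex T P \<longleftrightarrow>
     (\<forall>t\<in>{0..1}. polyhedron T (P t)) \<and>
     (\<forall>v\<in>vertices T. \<forall>i. real_analytic_on (\<lambda>t. P t v $ i) {0..1}) \<and>
     (\<forall>(v,w)\<in>edge_rel T. \<forall>t\<in>{0..1}. mlength (P t v - P t w) = mlength (P 0 v - P 0 w)) \<and>
     (\<exists>v\<in>vertices T. \<exists>w\<in>vertices T. \<exists>t\<in>{0..1}.
          mlength (P t v - P t w) \<noteq> mlength (P 0 v - P 0 w))"

end

theory Submission
  imports Defs "HOL-Computational_Algebra.Formal_Laurent_Series"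
begin

unbundle no fps_syntax

text \<open>Expand a flex at a parameter \<open>t\<close> into power series; its vertices become points of \<open>K\<^sup>3\<close>,
  where \<open>K\<close> is the field of Laurent series, with squared edge lengths in the constants. If the volume
  \<open>V\<close> were a nonconstant series, then \<open>w = V - V(0)\<close> would be transcendental over the constants, and Zorn's
  lemma would give a valuation ring \<open>A\<close> of \<open>K\<close> that contains the constants but not \<open>w\<close>. However,
  \<open>V \<in> A\<close> whenever the squared edge lengths lie in \<open>A\<close> (the bellows theorem of Sabitov, and
  Connelly, Sabitov and Walz): join two vertices if their squared distance lies in \<open>A\<close>.
  Since Gram determinants of four vectors vanish, every closed walk of at least four steps in the link of
  a vertex has a chord joining \<open>x\<^sub>i\<close> to \<open>x\<^sub>i\<^sub>+\<^sub>2\<close>. Hence \<open>H\<^sup>1\<close> of the links and, by induction on the number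
  of vertices, \<open>H\<^sup>2\<close> of the clique complex with coefficients in \<open>K / A\<close> vanish. The determinant is a
  2-cocycle modulo \<open>A\<close> since a tetrahedron whose edges all lie in the graph has volume in \<open>A\<close>. So it is
  modulo \<open>A\<close> the coboundary of a function on edges, whose sum over a closed surface cancels.\<close>

section \<open>Existence of valuation subrings\<close>

locale subring_set =
  fixes A :: "'a::field set"
  assumes one [simp]: "1 \<in> A"
    and diff: "x \<in> A \<Longrightarrow> y \<in> A \<Longrightarrow> x - y \<in> A"
    and mult: "x \<in> A \<Longrightarrow> y \<in> A \<Longrightarrow> x * y \<in> A"
begin

lemma zero [simp]: "0 \<in> A"
  using diff[OF one one] by simp

lemma uminus: "x \<in> A \<Longrightarrow> - x \<in> A"
  using diff[OF zero] by simp

lemma add: "x \<in> A \<Longrightarrow> y \<in> A \<Longrightarrow> x + y \<in> A"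
  using diff[of x "- y"] uminus by simp

lemma power: "x \<in> A \<Longrightarrow> x ^ n \<in> A"
  by (induction n) (auto intro: mult)

lemma sum: "(\<And>i. i \<in> I \<Longrightarrow> f i \<in> A) \<Longrightarrow> sum f I \<in> A"
  by (induction I rule: infinite_finite_induct) (auto intro: add)

lemma of_nat: "of_nat n \<in> A"
  by (induction n) (auto intro: add)

lemma numeral: "numeral n \<in> A"
  using of_nat[of "numeral n"] by simp

lemmas closed = zero one uminus add diff mult power numeral

end

definition adjoin :: "'a::field set \<Rightarrow> 'a \<Rightarrow> 'a set" where
  "adjoin A y = {poly p y | p. \<forall>i. coeff p i \<in> A}"

context subring_set
begin

lemma subset_adjoin: "A \<subseteq> adjoin A y"
proof
  fix a assume "a \<in> A"
  then have "\<forall>i. coeff [:a:] i \<in> A"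
    by (auto simp: coeff_pCons split: nat.split)
  then show "a \<in> adjoin A y"
    unfolding adjoin_def by (intro CollectI exI[of _ "[:a:]"]) auto
qed

lemma in_adjoin: "y \<in> adjoin A y"
proof -
  have "\<forall>i. coeff [:0, 1:] i \<in> A"
    by (auto simp: coeff_pCons split: nat.split)
  then show ?thesis
    unfolding adjoin_def by (intro CollectI exI[of _ "[:0, 1:]"]) auto
qed

lemma subring_set_adjoin: "subring_set (adjoin A y)"
proof
  show "1 \<in> adjoin A y"
    using subset_adjoin one by (rule subsetD)
  fix u v assume "u \<in> adjoin A y" "v \<in> adjoin A y"
  then obtain p q where u: "u = poly p y" "\<forall>i. coeff p i \<in> A"
    and v: "v = poly q y" "\<forall>i. coeff q i \<in> A"
    by (auto simp: adjoin_def)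
  have "\<forall>i. coeff (p - q) i \<in> A" "\<forall>i. coeff (p * q) i \<in> A"
    using u v by (auto simp: coeff_mult intro!: diff sum mult)
  moreover have "u - v = poly (p - q) y" "u * v = poly (p * q) y"
    using u v by auto
  ultimately show "u - v \<in> adjoin A y" "u * v \<in> adjoin A y"
    unfolding adjoin_def by blast+
qed

lemma poly_inverse_times_power:
  assumes "\<forall>i. coeff p i \<in> A" "z \<in> A" "z \<noteq> 0" "degree p \<le> n"
  shows "z ^ n * poly p (inverse z) \<in> A"
proof -
  have "z ^ n * poly p (inverse z) = (\<Sum>i\<le>degree p. coeff p i * z ^ (n - i))"
    unfolding poly_altdef sum_distrib_left
  proof (rule sum.cong)
    fix i assume "i \<in> {..degree p}"
    then have "z ^ n = z ^ (n - i) * z ^ i"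
      using assms(4) by (simp flip: power_add)
    then show "z ^ n * (coeff p i * inverse z ^ i) = coeff p i * z ^ (n - i)"
      using \<open>z \<noteq> 0\<close> by (simp add: field_simps)
  qed simp
  also have "\<dots> \<in> A"
    using assms by (auto intro!: sum mult power)
  finally show ?thesis .
qed

end

locale valuation_subring = subring_set +
  assumes valuation: "x \<in> A \<or> inverse x \<in> A"

section \<open>A subring maximal among those missing a given inverse is a valuation ring\<close>

locale maximal_avoiding = subring_set A for A :: "'a::field set" +
  fixes x :: 'a
  assumes x_mem: "x \<in> A"
    and avoid: "inverse x \<notin> A"
    and maximal: "subring_set B \<Longrightarrow> A \<subseteq> B \<Longrightarrow> inverse x \<notin> B \<Longrightarrow> B = A"
begin

lemma x_nonzero: "x \<noteq> 0"
  using avoid by auto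

lemma in_adjoin_if_notin:
  assumes "y \<notin> A"
  obtains p where "\<forall>i. coeff p i \<in> A" "inverse x = poly p y"
proof -
  have "inverse x \<in> adjoin A y"
    using maximal[OF subring_set_adjoin subset_adjoin] in_adjoin assms by metis
  then show ?thesis
    using that by (auto simp: adjoin_def)
qed

text \<open>This puts \<open>x\<close> into the Jacobson radical of \<open>A\<close>. If
  \<open>?z\<close> had no inverse in \<open>A\<close>, maximality would give
  \<open>inverse x\<close> as a polynomial in \<open>inverse ?z\<close>; clearing denominators
  brings \<open>?z ^ n / x\<close> into \<open>A\<close>, and \<open>?z ^ n\<close> is 1 modulo
  \<open>x A\<close>, so \<open>1 / x\<close> itself would lie in \<open>A\<close>.\<close>

lemma inverse_one_minus_mem:
  assumes "b \<in> A"
  shows "1 - x * b \<noteq> 0" "inverse (1 - x * b) \<in> A"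
proof -
  let ?z = "1 - x * b"
  have z: "?z \<in> A"
    using assms x_mem by (intro diff mult one)
  show nz: "?z \<noteq> 0"
  proof
    assume "?z = 0"
    then have "b = inverse x"
      using x_nonzero by (simp add: field_simps)
    then show False
      using assms avoid by simp
  qed
  show "inverse ?z \<in> A"
  proof (rule ccontr)
    assume "inverse ?z \<notin> A"
    then obtain p where p: "\<forall>i. coeff p i \<in> A" "inverse x = poly p (inverse ?z)"
      by (rule in_adjoin_if_notin)
    define n where "n = degree p"
    have a: "?z ^ n * inverse x \<in> A"
      unfolding p(2) using p(1) z nz by (intro poly_inverse_times_power) (auto simp: n_def)
    have "\<exists>e\<in>A. ?z ^ k = 1 - x * e" for k
    proof (induction k)
      case (Suc k)
      then obtain e where e: "e \<in> A" "?z ^ k = 1 - x * e"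
        by blast
      have "?z ^ Suc k = 1 - x * (e + b - x * b * e)"
        unfolding power_Suc e(2) by (simp add: algebra_simps)
      moreover have "e + b - x * b * e \<in> A"
        using e assms x_mem by (intro closed)
      ultimately show ?case
        by blast
    qed (auto intro!: bexI[of _ 0])
    then obtain e where e: "e \<in> A" "?z ^ n = 1 - x * e"
      by blast
    have "inverse x = ?z ^ n * inverse x + e"
      unfolding e(2) using x_nonzero by (simp add: field_simps)
    then show False
      using add[OF a e(1)] avoid by simp
  qed
qed

text \<open>If \<open>1 = x q(1/y)\<close> with \<open>q\<close> of degree \<open>m\<close>, then \<open>y\<^sup>m\<close> is a combination of lower powers
  of \<open>y\<close>, which reduces the degree of any \<open>p\<close> with \<open>1 = x p(y)\<close> and \<open>deg p \<ge> m\<close>.\<close>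
lemma reduce_degree:
  assumes "y \<noteq> 0" "y \<notin> A"
    and p: "\<forall>i. coeff p i \<in> A" "inverse x = poly p y"
    and q: "\<forall>i. coeff q i \<in> A" "inverse x = poly q (inverse y)"
    and deg: "degree q \<le> degree p"
  obtains p' where "\<forall>i. coeff p' i \<in> A" "inverse x = poly p' y" "degree p' < degree p"
proof -
  define n where "n = degree p"
  define m where "m = degree q"
  define u where "u = inverse (1 - x * coeff q 0)"
  \<comment> \<open>Solving \<open>1 = x q(1/y)\<close> for 1, which needs the unit
    \<open>1 - x * coeff q 0\<close>, and multiplying by \<open>y ^ n\<close> turns
    \<open>y ^ n\<close> into \<open>poly r y\<close>. As \<open>j\<close> starts at 1, only powers
    below \<open>n\<close> occur.\<close>
  define r where "r = (\<Sum>j = 1..m. monom (x * u * coeff q j) (n - j))"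
  have u: "u \<in> A" "1 - x * coeff q 0 \<noteq> 0"
    using inverse_one_minus_mem q(1) by (auto simp: u_def)
  have n_pos: "0 < n"
  proof (rule ccontr)
    assume "\<not> 0 < n"
    then obtain c where "p = [:c:]"
      unfolding n_def by (auto elim: degree_eq_zeroE)
    then have "coeff p 0 = inverse x"
      using p(2) by simp
    then show False
      using p(1) avoid by metis
  qed
  have m_le: "m \<le> n"
    using deg by (simp add: m_def n_def)
  have "1 = x * poly q (inverse y)"
    using q(2) x_nonzero by (simp add: field_simps)
  also have "\<dots> = x * (\<Sum>j = 0..m. coeff q j * inverse y ^ j)"
    by (simp add: poly_altdef m_def atLeast0AtMost)
  also have "\<dots> = x * coeff q 0 + x * (\<Sum>j = 1..m. coeff q j * inverse y ^ j)"
    by (simp add: sum.atLeast_Suc_atMost algebra_simps)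
  finally have "1 - x * coeff q 0 = x * (\<Sum>j = 1..m. coeff q j * inverse y ^ j)"
    by (simp add: algebra_simps)
  then have "u * (1 - x * coeff q 0) = u * (x * (\<Sum>j = 1..m. coeff q j * inverse y ^ j))"
    by simp
  then have eq: "1 = (\<Sum>j = 1..m. x * u * coeff q j * inverse y ^ j)"
    using u(2) by (simp add: u_def sum_distrib_left mult_ac)
  have "y ^ n = y ^ n * (\<Sum>j = 1..m. x * u * coeff q j * inverse y ^ j)"
    using eq by simp
  also have "\<dots> = poly r y"
    unfolding r_def poly_sum poly_monom sum_distrib_left
  proof (rule sum.cong)
    fix j assume "j \<in> {1..m}"
    then have "y ^ n = y ^ (n - j) * y ^ j"
      using m_le by (simp flip: power_add)
    then show "y ^ n * (x * u * coeff q j * inverse y ^ j) = x * u * coeff q j * y ^ (n - j)"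
      using \<open>y \<noteq> 0\<close> by (simp add: field_simps)
  qed simp
  finally have yn: "y ^ n = poly r y" .
  have r_coeff: "coeff r i \<in> A" for i
    unfolding r_def coeff_sum using x_mem u q(1) by (auto intro!: sum mult)
  have r_high: "coeff r i = 0" if "n \<le> i" for i
    unfolding r_def coeff_sum using that n_pos m_le by (intro sum.neutral) auto
  define p' where "p' = p - monom (coeff p n) n + smult (coeff p n) r"
  have "coeff p' i = 0" if "n \<le> i" for i
    using that r_high[of i] by (cases "i = n") (auto simp: p'_def n_def coeff_eq_0)
  then have "degree p' < n"
    using n_pos by (metis leading_coeff_0_iff not_le degree_0)
  moreover have "\<forall>i. coeff p' i \<in> A"
    using p(1) r_coeff by (auto simp: p'_def intro!: closed)
  moreover have "poly p' y = inverse x"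
    using yn p(2) by (simp add: p'_def poly_monom)
  ultimately show ?thesis
    using that[of p'] by (simp add: n_def)
qed

text \<open>Otherwise \<open>1 / x\<close> would be a polynomial over \<open>A\<close> in
  \<open>y\<close> and also one in \<open>1 / y\<close>. Take both of least degree:
  \<open>reduce_degree\<close> shortens the one whose degree is not the smaller, a
  contradiction.\<close>

lemma valuation_subring: "valuation_subring A"
proof
  fix y
  show "y \<in> A \<or> inverse y \<in> A"
  proof (rule ccontr)
    assume "\<not> (y \<in> A \<or> inverse y \<in> A)"
    then have y: "y \<notin> A" "inverse y \<notin> A" "y \<noteq> 0"
      by auto
    define S where "S z = (\<lambda>p. (\<forall>i. coeff p i \<in> A) \<and> inverse x = poly p z)" for z
    have "\<exists>p. S z p \<and> (\<forall>p'. S z p' \<longrightarrow> degree p \<le> degree p')" if "z \<notin> A" for z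
      using in_adjoin_if_notin[OF that] ex_has_least_nat[of "S z" _ degree] unfolding S_def by metis
    from this[OF y(1)] this[OF y(2)] obtain p q
      where p: "S y p" "\<And>p'. S y p' \<Longrightarrow> degree p \<le> degree p'"
        and q: "S (inverse y) q" "\<And>q'. S (inverse y) q' \<Longrightarrow> degree q \<le> degree q'"
      by blast
    \<comment> \<open>Stated for any \<open>z\<close>, so that it applies to \<open>y\<close> and,
      with the roles of \<open>p\<close> and \<open>q\<close> exchanged, to
      \<open>inverse y\<close>.\<close>
    have no_descent: False
      if H: "degree q \<le> degree p" "S z p" "\<And>p'. S z p' \<Longrightarrow> degree p \<le> degree p'"
        "S (inverse z) q" "z \<noteq> 0" "z \<notin> A" for z p q
    proof -
      have P: "\<forall>i. coeff p i \<in> A" "inverse x = poly p z"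
        and Q: "\<forall>i. coeff q i \<in> A" "inverse x = poly q (inverse z)"
        using H(2,4) unfolding S_def by blast+
      obtain p' where "\<forall>i. coeff p' i \<in> A" "inverse x = poly p' z" "degree p' < degree p"
        by (rule reduce_degree[OF H(5,6) P Q H(1)])
      then show False
        using H(3)[of p'] unfolding S_def by simp
    qed
    show False
    proof (cases "degree q \<le> degree p")
      case True
      show False
        by (rule no_descent[OF True p q(1) y(3,1)])
    next
      case False
      then have "degree p \<le> degree q"
        by simp
      moreover have "S (inverse (inverse y)) p" "inverse y \<noteq> 0"
        using p(1) y(3) by simp_all
      ultimately show False
        using no_descent[OF _ q _ _ y(2)] by blast
    qed
  qed
qed

end

text \<open>Unions of chains still miss \<open>inverse x\<close>, so Zorn's lemma supplies a maximal
  ring to which \<open>maximal_avoiding\<close> applies.\<close>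

theorem (in subring_set) exists_valuation_subring_avoiding:
  assumes "x \<in> A" "inverse x \<notin> A"
  shows "\<exists>B. valuation_subring B \<and> A \<subseteq> B \<and> inverse x \<notin> B"
proof -
  define \<A> where "\<A> = {B. subring_set B \<and> A \<subseteq> B \<and> inverse x \<notin> B}"
  have "\<exists>M\<in>\<A>. \<forall>X\<in>\<A>. M \<subseteq> X \<longrightarrow> X = M"
  proof (rule subset_Zorn_nonempty)
    show "\<A> \<noteq> {}"
      using assms subring_set_axioms by (auto simp: \<A>_def)
    fix \<C> assume ne: "\<C> \<noteq> {}" and ch: "subset.chain \<A> \<C>"
    have C: "subring_set B" "A \<subseteq> B" "inverse x \<notin> B" if "B \<in> \<C>" for B
      using ch that by (auto simp: subset.chain_def \<A>_def)
    have "subring_set (\<Union>\<C>)"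
    proof
      show "1 \<in> \<Union>\<C>"
        using ne C(1) subring_set.one by blast
      fix u v assume "u \<in> \<Union>\<C>" "v \<in> \<Union>\<C>"
      then obtain B1 B2 where "B1 \<in> \<C>" "u \<in> B1" "B2 \<in> \<C>" "v \<in> B2"
        by blast
      moreover from this have "B1 \<subseteq> B2 \<or> B2 \<subseteq> B1"
        using ch by (auto simp: subset_chain_def)
      ultimately obtain B where "B \<in> \<C>" "u \<in> B" "v \<in> B"
        by blast
      then have "u - v \<in> B" "u * v \<in> B"
        using C(1) subring_set.diff subring_set.mult by metis+
      then show "u - v \<in> \<Union>\<C>" "u * v \<in> \<Union>\<C>"
        using \<open>B \<in> \<C>\<close> by blast+
    qed
    moreover have "A \<subseteq> \<Union>\<C>"
      using ne C(2) by blast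
    moreover have "inverse x \<notin> \<Union>\<C>"
      using C(3) by blast
    ultimately show "\<Union>\<C> \<in> \<A>"
      by (simp add: \<A>_def)
  qed
  then obtain M where M: "M \<in> \<A>" "\<And>X. X \<in> \<A> \<Longrightarrow> M \<subseteq> X \<Longrightarrow> X = M"
    by blast
  interpret M: subring_set M
    using M(1) by (simp add: \<A>_def)
  have M_props: "A \<subseteq> M" "inverse x \<notin> M"
    using M(1) by (auto simp: \<A>_def)
  have "maximal_avoiding M x"
  proof
    show "x \<in> M" "inverse x \<notin> M"
      using M_props assms(1) by auto
    fix B assume "subring_set B" "M \<subseteq> B" "inverse x \<notin> B"
    then show "B = M"
      using M(2)[of B] M_props(1) by (auto simp: \<A>_def)
  qed
  then show ?thesis
    using M_props maximal_avoiding.valuation_subring by blast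
qed

section \<open>Growth of scalar products in Minkowski space\<close>

context valuation_subring
begin

text \<open>The nonunits of \<open>A\<close>. Zero is listed separately because
  \<open>inverse 0 = 0\<close> lies in \<open>A\<close>.\<close>

definition max_ideal :: "'a set" where
  "max_ideal = {z \<in> A. z = 0 \<or> inverse z \<notin> A}"

lemma max_ideal_mult:
  assumes "z \<in> max_ideal" "u \<in> A"
  shows "z * u \<in> max_ideal"
proof (cases "z * u = 0")
  case False
  have "inverse z = u * inverse (z * u)"
    using False by (simp add: field_simps)
  moreover have "inverse z \<notin> A"
    using assms(1) False by (auto simp: max_ideal_def)
  ultimately have "inverse (z * u) \<notin> A"
    using assms(2) mult by metis
  then show ?thesis
    using assms by (auto simp: max_ideal_def intro: mult)
next
  case True
  then show ?thesis
    by (metis (lifting) max_ideal_def mem_Collect_eq zero)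
qed

text \<open>One of \<open>z / w\<close> and \<open>w / z\<close> lies in \<open>A\<close>, so the
  sum is a multiple of a single nonunit.\<close>

lemma max_ideal_add:
  assumes "z \<in> max_ideal" "w \<in> max_ideal"
  shows "z + w \<in> max_ideal"
proof -
  have *: "z + w \<in> max_ideal"
    if H: "z \<in> max_ideal" "w \<in> max_ideal" "w \<noteq> 0" "z / w \<in> A" for z w
  proof -
    have "1 + z / w \<in> A"
      using H(4) by (intro add one)
    from max_ideal_mult[OF H(2) this] show ?thesis
      using H(3) by (simp add: distrib_left add.commute)
  qed
  show ?thesis
  proof (cases "z = 0 \<or> w = 0")
    case False
    then show ?thesis
      using *[OF assms] *[OF assms(2,1)] valuation[of "z / w"] by (auto simp: add.commute)
  qed (use assms in auto)
qed

lemma one_notin_max_ideal: "1 \<notin> max_ideal"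
  by (simp add: max_ideal_def)

lemma inverse_in_max_ideal: "z \<notin> A \<Longrightarrow> inverse z \<in> max_ideal"
  using valuation[of z] by (auto simp: max_ideal_def)

lemma in_max_ideal_if_inverse_notin: "inverse z \<notin> A \<Longrightarrow> z \<in> max_ideal"
  using valuation[of z] by (auto simp: max_ideal_def)

text \<open>The case of integral closedness that passes from Gram determinants to volumes.\<close>

lemma square_mem:
  assumes "z\<^sup>2 \<in> A"
  shows "z \<in> A"
proof (rule ccontr)
  assume "z \<notin> A"
  then have "inverse z \<in> A" "z \<noteq> 0"
    using valuation[of z] by auto
  then have "z\<^sup>2 * inverse z \<in> A" "z\<^sup>2 * inverse z = z"
    using assms by (auto intro: mult simp: power2_eq_square)
  then show False
    using \<open>z \<notin> A\<close> by simp
qed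

end

section \<open>The Minkowski form over commutative rings and its Gram identities\<close>

definition mform :: "'a::comm_ring_1 ^ 3 \<Rightarrow> 'a ^ 3 \<Rightarrow> 'a" where
  "mform x y = x$1 * y$1 + x$2 * y$2 - x$3 * y$3"

lemma mform_minus_minus: "mform (- x) (- y) = mform x y"
  by (simp add: mform_def)

lemma mform_diff_commute: "mform (x - y) (x - y) = mform (y - x) (y - x)"
  using mform_minus_minus[of "x - y" "x - y"] by simp

lemma mform_polarization:
  "2 * mform (x - z) (y - z) = mform (x - z) (x - z) + mform (y - z) (y - z) - mform (x - y) (x - y)"
  by (simp add: mform_def algebra_simps)

text \<open>The left side is the expanded Gram determinant of four vectors, which are dependent in
  dimension three.\<close>

lemma mform_gram4:
  fixes u1 u2 u3 u4 :: "'a::field ^ 3"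
  assumes "s1 = mform u1 u1" "s2 = mform u2 u2" "s3 = mform u3 u3" "s4 = mform u4 u4"
    and "x = mform u1 u2" "b = mform u1 u3" "c = mform u1 u4"
    and "e = mform u2 u3" "a = mform u2 u4" "f = mform u3 u4"
  shows "s1 * s2 * s3 * s4 - s1 * s2 * f\<^sup>2 - s1 * s3 * a\<^sup>2 - s1 * s4 * e\<^sup>2 - s2 * s3 * c\<^sup>2
    - s2 * s4 * b\<^sup>2 - s3 * s4 * x\<^sup>2 + 2 * s1 * e * a * f + 2 * s2 * b * c * f + 2 * s3 * x * a * c
    + 2 * s4 * x * b * e + x\<^sup>2 * f\<^sup>2 + b\<^sup>2 * a\<^sup>2 + c\<^sup>2 * e\<^sup>2 - 2 * x * f * b * a - 2 * x * f * c * e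
    - 2 * b * a * c * e = 0"
  unfolding assms mform_def by algebra

text \<open>The Gram matrix is \<open>M J M^T\<close> with \<open>J = diag(1, 1, -1)\<close>, whence
  the minus sign.\<close>

lemma det_square_eq_gram3:
  fixes u v w :: "'a::field ^ 3"
  assumes "s1 = mform u u" "s2 = mform v v" "s3 = mform w w"
    and "x = mform u v" "y = mform v w" "z = mform u w"
  shows "(det (vector [u, v, w] :: 'a^3^3))\<^sup>2 =
    - (s1 * s2 * s3 + 2 * x * y * z - s1 * y\<^sup>2 - s2 * z\<^sup>2 - s3 * x\<^sup>2)"
  unfolding assms mform_def det_3 vector_3 by algebra

context valuation_subring
begin

text \<open>If \<open>c / (a b)\<close> lay in the maximal ideal, the term \<open>a\<^sup>2 b\<^sup>2\<close> would strictly dominate all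
  other terms of the vanishing Gram determinant of the four vectors.\<close>
lemma gram_growth:
  assumes mem: "mform u1 u1 \<in> A" "mform u2 u2 \<in> A" "mform u3 u3 \<in> A" "mform u4 u4 \<in> A"
      "mform u2 u3 \<in> A" "mform u3 u4 \<in> A"
    and a: "mform u2 u4 \<notin> A" and b: "mform u1 u3 \<notin> A" and x: "mform u1 u2 / mform u1 u3 \<in> A"
  shows "mform u1 u4 \<notin> A" "mform u1 u3 / mform u1 u4 \<in> A"
proof -
  define s1 s2 s3 s4 e f where
    s_def: "s1 = mform u1 u1" "s2 = mform u2 u2" "s3 = mform u3 u3" "s4 = mform u4 u4"
      "e = mform u2 u3" "f = mform u3 u4"
  \<comment> \<open>Dividing by the products outside \<open>A\<close> leaves elements of
    \<open>A\<close>, except that \<open>\<gamma>\<close>, the \<open>c / (a b)\<close> above, is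
    still to be controlled.\<close>
  define \<alpha> \<beta> \<xi> \<gamma> where greek: "\<alpha> = inverse (mform u2 u4)" "\<beta> = inverse (mform u1 u3)"
    "\<xi> = mform u1 u2 * \<beta>" "\<gamma> = mform u1 u4 * \<alpha> * \<beta>"
  have nz: "mform u2 u4 \<noteq> 0" "mform u1 u3 \<noteq> 0" "\<alpha> \<noteq> 0" "\<beta> \<noteq> 0"
    using a b greek by auto
  have ab: "mform u2 u4 = inverse \<alpha>" "mform u1 u3 = inverse \<beta>" "mform u1 u2 = \<xi> * inverse \<beta>"
    "mform u1 u4 = \<gamma> * inverse \<alpha> * inverse \<beta>"
    using nz by (simp_all add: greek field_simps)
  have ideal: "\<alpha> \<in> max_ideal" "\<beta> \<in> max_ideal"
    using a b by (simp_all add: greek inverse_in_max_ideal)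
  have A: "\<alpha> \<in> A" "\<beta> \<in> A" "\<xi> \<in> A" "s1 \<in> A" "s2 \<in> A" "s3 \<in> A" "s4 \<in> A" "e \<in> A" "f \<in> A"
    using ideal x mem by (auto simp: max_ideal_def greek s_def divide_inverse)
  have "\<gamma> \<notin> max_ideal"
  proof
    assume \<gamma>: "\<gamma> \<in> max_ideal"
    then have "\<gamma> \<in> A"
      by (simp add: max_ideal_def)
    \<comment> \<open>The Gram relation is multiplied by
      \<open>\<alpha>\<^sup>2 * \<beta>\<^sup>2\<close>, so that
      \<open>a\<^sup>2 * b\<^sup>2\<close> becomes 1; the other terms are grouped by a factor
      \<open>\<alpha>\<close>, \<open>\<beta>\<close> or \<open>\<gamma>\<close> from the maximal
      ideal.\<close>
    define U where "U = - (s1 * s2 * (s3 * s4) * \<alpha> * \<beta>\<^sup>2) + s1 * s2 * f\<^sup>2 * \<alpha> * \<beta>\<^sup>2 + s1 * s4 * e\<^sup>2 * \<alpha> * \<beta>\<^sup>2 + s2 * s4 * \<alpha> + s3 * s4 * \<xi>\<^sup>2 * \<alpha>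
      - 2 * s1 * e * f * \<beta>\<^sup>2 - 2 * s2 * \<gamma> * f - 2 * s4 * \<xi> * e * \<alpha> - \<xi>\<^sup>2 * f\<^sup>2 * \<alpha> + 2 * \<xi> * f + 2 * \<xi> * \<gamma> * f * e"
    define W where "W = s2 * s3 * \<gamma> - 2 * s3 * \<xi> - \<gamma> * e\<^sup>2 + 2 * e"
    have "U \<in> A" "W \<in> A" "s1 * s3 * \<beta> \<in> A"
      unfolding U_def W_def by (intro closed A \<open>\<gamma> \<in> A\<close>)+
    then have "\<alpha> * U + \<beta> * (s1 * s3 * \<beta>) + \<gamma> * W \<in> max_ideal"
      using ideal \<gamma> by (intro max_ideal_add max_ideal_mult)
    moreover have "\<alpha> * U + \<beta> * (s1 * s3 * \<beta>) + \<gamma> * W = 1"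
    proof -
      define a b x c where gram: "a = mform u2 u4" "b = mform u1 u3" "x = mform u1 u2" "c = mform u1 u4"
      have "a * \<alpha> = 1" "b * \<beta> = 1" "x = \<xi> * b" "c = \<gamma> * a * b"
        using nz by (simp_all add: gram greek field_simps)
      then have "1 - (\<alpha> * U + \<beta> * (s1 * s3 * \<beta>) + \<gamma> * W) = \<alpha>\<^sup>2 * \<beta>\<^sup>2 *
        (s1 * s2 * s3 * s4 - s1 * s2 * f\<^sup>2 - s1 * s3 * a\<^sup>2 - s1 * s4 * e\<^sup>2 - s2 * s3 * c\<^sup>2
          - s2 * s4 * b\<^sup>2 - s3 * s4 * x\<^sup>2 + 2 * s1 * e * a * f + 2 * s2 * b * c * f + 2 * s3 * x * a * c
          + 2 * s4 * x * b * e + x\<^sup>2 * f\<^sup>2 + b\<^sup>2 * a\<^sup>2 + c\<^sup>2 * e\<^sup>2 - 2 * x * f * b * a - 2 * x * f * c * e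
          - 2 * b * a * c * e)"
        unfolding U_def W_def by algebra
      then show ?thesis
        using mform_gram4[OF s_def(1-4) gram(3,2,4) s_def(5) gram(1) s_def(6)] by simp
    qed
    ultimately show False
      using one_notin_max_ideal by simp
  qed
  moreover have "0 \<in> max_ideal"
    by (simp add: max_ideal_def)
  ultimately have g: "inverse \<gamma> \<in> A" "\<gamma> \<noteq> 0"
    using in_max_ideal_if_inverse_notin by blast+
  have "mform u1 u3 / mform u1 u4 = \<alpha> * inverse \<gamma>"
    unfolding ab using nz g by (simp add: field_simps)
  then show quot: "mform u1 u3 / mform u1 u4 \<in> A"
    using A(1) g(1) mult by simp
  show "mform u1 u4 \<notin> A"
  proof
    assume "mform u1 u4 \<in> A"
    from mult[OF this quot] show False
      using b g nz by (simp add: ab)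
  qed
qed

text \<open>Walking along \<open>q\<close>, \<open>gram_growth\<close> carries the property of
  leaving \<open>A\<close> from \<open>q 0, q k\<close> to \<open>q 0, q (Suc k)\<close>. The
  quotient in the induction claim is the hypothesis it needs for the next step.\<close>

lemma no_short_chord_growth:
  fixes q :: "nat \<Rightarrow> 'a ^ 3"
  assumes "\<And>i. i \<le> n \<Longrightarrow> mform (q i) (q i) \<in> A"
    and "\<And>i. i < n \<Longrightarrow> mform (q i) (q (Suc i)) \<in> A"
    and "\<And>i. i + 2 \<le> n \<Longrightarrow> mform (q i) (q (i + 2)) \<notin> A"
    and "2 \<le> n"
  shows "mform (q 0) (q n) \<notin> A"
proof -
  have "mform (q 0) (q k) \<notin> A \<and> mform (q 0) (q (k - 1)) / mform (q 0) (q k) \<in> A"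
    if "2 \<le> k" "k \<le> n" for k
    using that
  proof (induction k rule: dec_induct)
    case base
    have *: "mform (q 0) (q 2) \<notin> A"
      using assms(3)[of 0] base by (simp add: numeral_2_eq_2)
    then have "inverse (mform (q 0) (q 2)) \<in> A"
      using valuation by blast
    moreover have "mform (q 0) (q 1) \<in> A"
      using assms(2)[of 0] base by simp
    ultimately show ?case
      using * by (simp add: divide_inverse mult)
  next
    case (step k)
    obtain j where k: "k = Suc j"
      using step.hyps by (cases k) auto
    show ?case
      using gram_growth[of "q 0" "q j" "q k" "q (Suc k)"] step assms(1)[of 0] assms(1)[of j]
        assms(1)[of k] assms(1)[of "Suc k"] assms(2)[of j] assms(2)[of k] assms(3)[of j]
      by (simp add: k)
  qed
  then show ?thesis
    using assms(4) by blast
qed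

end

section \<open>Cocycles on clique complexes\<close>

fun walk_sum :: "('v \<Rightarrow> 'v \<Rightarrow> 'a::ab_group_add) \<Rightarrow> 'v list \<Rightarrow> 'a" where
  "walk_sum h (x # y # zs) = h x y + walk_sum h (y # zs)"
| "walk_sum h _ = 0"

lemma walk_sum_append:
  "walk_sum h (xs @ y # ys) = walk_sum h (xs @ [y]) + walk_sum h (y # ys)"
  by (induction h xs rule: walk_sum.induct) (auto simp: algebra_simps)

lemma walk_sum_append2:
  "walk_sum h (xs @ x # y # ys) = walk_sum h (xs @ [x]) + h x y + walk_sum h (y # ys)"
  by (subst walk_sum_append) (simp add: algebra_simps)

lemma walk_sum_rev:
  assumes "\<And>x y. h x y = - h y x"
  shows "walk_sum h (rev xs) = - walk_sum h xs"
proof (induction xs rule: induct_list012)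
  case (3 x y zs)
  then show ?case
    using assms[of y x] by (simp add: walk_sum_append2[of h _ y x "[]", simplified])
qed auto

text \<open>Closed walks of length three satisfy the condition trivially. For longer ones it yields the
  vanishing of \<open>H\<^sup>1\<close> of the clique complex.\<close>
definition chorded :: "('v \<Rightarrow> 'v \<Rightarrow> bool) \<Rightarrow> 'v set \<Rightarrow> bool" where
  "chorded E N \<longleftrightarrow> (\<forall>xs. 3 \<le> length xs \<longrightarrow> set xs \<subseteq> N \<longrightarrow> successively E xs \<longrightarrow> E (hd xs) (last xs) \<longrightarrow>
     (\<exists>us a b c vs. xs = us @ a # b # c # vs \<and> E a c))"

lemma chordedD:
  assumes "chorded E N" "3 \<le> length xs" "set xs \<subseteq> N" "successively E xs" "E (hd xs) (last xs)"
  obtains us a b c vs where "xs = us @ a # b # c # vs" "E a c"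
  using assms unfolding chorded_def by metis

locale graph_mod = subring_set A for A :: "'a::field_char_0 set" +
  fixes E :: "'v \<Rightarrow> 'v \<Rightarrow> bool"
  assumes E_refl: "E x x" and E_sym: "E x y \<Longrightarrow> E y x"
begin

text \<open>Shortcutting \<open>a, b, c\<close> to \<open>a, c\<close> along a chord changes the sum
  by an element of \<open>A\<close>. This ends at walks with one or two vertices, whose sums vanish
  by antisymmetry.\<close>

lemma closed_walk_sum:
  assumes chorded: "chorded E N"
    and anti: "\<And>x y. h x y = - h y x"
    and cocycle: "\<And>a b c. a \<in> N \<Longrightarrow> b \<in> N \<Longrightarrow> c \<in> N \<Longrightarrow> E a b \<Longrightarrow> E b c \<Longrightarrow> E a c \<Longrightarrow>
      h a b + h b c - h a c \<in> A"
    and walk: "xs \<noteq> []" "set xs \<subseteq> N" "successively E xs" "E (hd xs) (last xs)"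
  shows "walk_sum h xs + h (last xs) (hd xs) \<in> A"
  using walk
proof (induction xs rule: length_induct)
  case (1 xs)
  have self: "h x x = 0" for x
    using anti[of x x] by (simp add: eq_neg_iff_add_eq_0)
  show ?case
  proof (cases "3 \<le> length xs")
    case True
    then obtain us a b c vs where xs: "xs = us @ a # b # c # vs" and "E a c"
      using chordedD[OF chorded] 1 by metis
    define ys where "ys = us @ a # c # vs"
    have hl: "hd ys = hd xs" "last ys = last xs"
      by (auto simp: xs ys_def hd_append)
    have "length ys < length xs" "ys \<noteq> []" "set ys \<subseteq> N" "successively E ys" "E (hd ys) (last ys)"
      using 1(3-5) \<open>E a c\<close> unfolding hl
      by (auto simp: xs ys_def successively_append_iff successively_Cons)
    then have "walk_sum h ys + h (last ys) (hd ys) \<in> A"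
      using 1(1) by blast
    moreover have "h a b + h b c - h a c \<in> A"
      using 1 \<open>E a c\<close> by (intro cocycle) (auto simp: xs successively_append_iff)
    ultimately have "walk_sum h ys + h (last ys) (hd ys) + (h a b + h b c - h a c) \<in> A"
      by (rule add)
    moreover have "walk_sum h ys + h (last ys) (hd ys) + (h a b + h b c - h a c) =
        walk_sum h xs + h (last xs) (hd xs)"
      unfolding hl by (simp add: xs ys_def walk_sum_append2)
    ultimately show ?thesis
      by simp
  next
    case False
    then consider x where "xs = [x]" | x y where "xs = [x, y]"
      using 1 by (cases xs rule: remdups_adj.cases) (auto simp: not_less_eq_eq)
    then show ?thesis
      using anti self by cases (auto simp: eq_neg_iff_add_eq_0)
  qed
qed

text \<open>The potential \<open>u\<close> sums \<open>h\<close> along a walk from a root of each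
  component; by \<open>closed_walk_sum\<close> the choice of walk does not matter modulo
  \<open>A\<close>.\<close>

lemma link_potential:
  assumes chorded: "chorded E N"
    and anti: "\<And>x y. h x y = - h y x"
    and cocycle: "\<And>a b c. a \<in> N \<Longrightarrow> b \<in> N \<Longrightarrow> c \<in> N \<Longrightarrow> E a b \<Longrightarrow> E b c \<Longrightarrow> E a c \<Longrightarrow>
      h a b + h b c - h a c \<in> A"
  shows "\<exists>u. \<forall>x\<in>N. \<forall>y\<in>N. E x y \<longrightarrow> h x y - (u y - u x) \<in> A"
proof -
  define W where "W x y xs \<longleftrightarrow> xs \<noteq> [] \<and> hd xs = x \<and> last xs = y \<and> set xs \<subseteq> N \<and> successively E xs"
    for x y xs
  have W_rev: "W y x (rev xs)" if "W x y xs" for x y xs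
  proof -
    have "successively (\<lambda>x y. E y x) xs"
      using that E_sym unfolding W_def by (auto intro: successively_mono)
    then show ?thesis
      using that by (auto simp: W_def hd_rev last_rev)
  qed
  have W_edge: "W x z (xs @ [z])" if "W x y xs" "E y z" "z \<in> N" for x y z xs
    using that by (auto simp: W_def successively_append_iff)
  \<comment> \<open>\<open>SOME\<close> depends only on the set of possible starting points, which
    adjacent vertices share, so \<open>r\<close> is constant on components.\<close>
  define r where "r x = (SOME z. \<exists>xs. W z x xs)" for x :: 'v
  define w where "w x = (SOME xs. W (r x) x xs)" for x :: 'v
  define u where "u x = walk_sum h (w x)" for x :: 'v
  have w: "W (r x) x (w x)" if "x \<in> N" for x
  proof -
    have "W x x [x]"
      using that by (simp add: W_def)
    then have "\<exists>xs. W (r x) x xs"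
      unfolding r_def by (intro someI_ex[of "\<lambda>z. \<exists>xs. W z x xs"]) blast
    then show ?thesis
      unfolding w_def by (rule someI_ex)
  qed
  have r_eq: "r x = r y" if "x \<in> N" "y \<in> N" "E x y" for x y
  proof -
    have "(\<exists>xs. W z x xs) \<longleftrightarrow> (\<exists>xs. W z y xs)" for z
      using W_edge that E_sym by metis
    then show ?thesis
      by (simp add: r_def)
  qed
  have "h x y - (u y - u x) \<in> A" if xy: "x \<in> N" "y \<in> N" "E x y" for x y
  proof -
    have Wx: "W (r x) x (w x)" and Wy: "W y (r x) (rev (w y))"
      using w[OF xy(1)] W_rev[OF w[OF xy(2)]] r_eq[OF xy] by simp_all
    obtain us where us: "w x = us @ [x]"
      using Wx unfolding W_def by (metis append_butlast_last_id)
    obtain vs where vs: "rev (w y) = y # vs"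
      using Wy unfolding W_def by (metis list.collapse)
    \<comment> \<open>A loop at the root: out to \<open>x\<close>, across the edge to
      \<open>y\<close>, and back. Its closing term is \<open>h (r x) (r x) = 0\<close>.\<close>
    define xs where "xs = us @ x # y # vs"
    have xs: "xs = w x @ rev (w y)"
      unfolding xs_def us vs by simp
    have "successively E xs"
      using Wx Wy xy(3) by (auto simp: xs W_def successively_append_iff)
    moreover have "set xs \<subseteq> N"
      using Wx Wy by (auto simp: xs W_def)
    moreover have "hd xs = r x" "last xs = r x" "xs \<noteq> []"
      using Wx Wy by (auto simp: xs W_def)
    moreover have "h (r x) (r x) = 0"
      using anti[of "r x" "r x"] by (simp add: eq_neg_iff_add_eq_0)
    ultimately have "walk_sum h xs \<in> A"
      using closed_walk_sum[where N = N and h = h and xs = xs, OF chorded anti cocycle] E_refl by simp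
    also have "walk_sum h xs = u x + h x y + walk_sum h (rev (w y))"
      unfolding xs_def walk_sum_append2 by (simp add: u_def us vs)
    also have "\<dots> = h x y - (u y - u x)"
      unfolding walk_sum_rev[OF anti] by (simp add: u_def algebra_simps)
    finally show ?thesis .
  qed
  then show ?thesis
    by blast
qed

text \<open>Vanishing of \<open>H\<^sup>2\<close> of the clique complex with coefficients in the field modulo \<open>A\<close>:
  adding a vertex \<open>v\<close> glues a cone over its link, and \<open>H\<^sup>1\<close> of the link vanishes.\<close>
lemma two_cocycle_is_coboundary:
  assumes "finite V"
    and "\<And>v. v \<in> V \<Longrightarrow> chorded E {a \<in> V. E v a}"
    and alt: "\<And>a b c. f b a c = - f a b c" "\<And>a b c. f b c a = f a b c"
    and "\<And>a b c d. {a, b, c, d} \<subseteq> V \<Longrightarrow> E a b \<Longrightarrow> E a c \<Longrightarrow> E a d \<Longrightarrow> E b c \<Longrightarrow> E b d \<Longrightarrow> E c d \<Longrightarrow>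
      f b c d - f a c d + f a b d - f a b c \<in> A"
  shows "\<exists>g. (\<forall>a b. g a b = - g b a) \<and>
    (\<forall>a\<in>V. \<forall>b\<in>V. \<forall>c\<in>V. E a b \<longrightarrow> E b c \<longrightarrow> E c a \<longrightarrow> f a b c - (g a b + g b c + g c a) \<in> A)"
  using assms(1,2,5)
proof (induction V rule: finite_induct)
  case empty
  then show ?case
    by (intro exI[of _ "\<lambda>_ _. 0"]) auto
next
  case (insert v V)
  have chorded: "chorded E {a \<in> V. E w a}" if "w \<in> insert v V" for w
    using insert.prems(1)[OF that] unfolding chorded_def by (simp add: subset_iff)
  have "\<exists>g. (\<forall>a b. g a b = - g b a) \<and>
    (\<forall>a\<in>V. \<forall>b\<in>V. \<forall>c\<in>V. E a b \<longrightarrow> E b c \<longrightarrow> E c a \<longrightarrow> f a b c - (g a b + g b c + g c a) \<in> A)"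
  proof (rule insert.IH)
    show "chorded E {a \<in> V. E w a}" if "w \<in> V" for w
      using chorded that by simp
    fix a b c d assume "{a, b, c, d} \<subseteq> V" and E: "E a b" "E a c" "E a d" "E b c" "E b d" "E c d"
    then have "{a, b, c, d} \<subseteq> insert v V"
      by blast
    from insert.prems(2)[OF this E] show "f b c d - f a c d + f a b d - f a b c \<in> A" .
  qed
  then obtain g where g_anti: "\<And>a b. g a b = - g b a"
    and g: "\<And>a b c. a \<in> V \<Longrightarrow> b \<in> V \<Longrightarrow> c \<in> V \<Longrightarrow> E a b \<Longrightarrow> E b c \<Longrightarrow> E c a \<Longrightarrow>
      f a b c - (g a b + g b c + g c a) \<in> A"
    by blast
  define N where "N = {a \<in> V. E v a}"
  define h where "h a b = f v a b - g a b" for a b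
  have f_swap: "f a c b = - f a b c" for a b c
    using alt by metis
  have f_zero: "f a a b = 0" "f a b a = 0" "f b a a = 0" for a b
  proof -
    show "f a a b = 0"
      using alt(1)[of a a b] by (simp add: eq_neg_iff_add_eq_0)
    then show "f a b a = 0" "f b a a = 0"
      using alt(2) by metis+
  qed
  have g_zero: "g a a = 0" for a
    using g_anti[of a a] by (simp add: eq_neg_iff_add_eq_0)
  have "\<exists>u. \<forall>x\<in>N. \<forall>y\<in>N. E x y \<longrightarrow> h x y - (u y - u x) \<in> A"
  proof (rule link_potential)
    show "chorded E N"
      using chorded by (simp add: N_def)
    show "h x y = - h y x" for x y
      unfolding h_def f_swap[of v x y] g_anti[of x y] by simp
    fix a b c assume abc: "a \<in> N" "b \<in> N" "c \<in> N" "E a b" "E b c" "E a c"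
    have "f a b c - f v b c + f v a c - f v a b \<in> A"
      using abc by (intro insert.prems(2)) (auto simp: N_def)
    moreover have "f a b c - (g a b + g b c + g c a) \<in> A"
      using abc E_sym by (intro g) (auto simp: N_def)
    ultimately have "f a b c - (g a b + g b c + g c a) - (f a b c - f v b c + f v a c - f v a b) \<in> A"
      by (rule diff[rotated])
    then show "h a b + h b c - h a c \<in> A"
      unfolding h_def g_anti[of c a] by (simp add: algebra_simps)
  qed
  then obtain u where u: "\<And>x y. x \<in> N \<Longrightarrow> y \<in> N \<Longrightarrow> E x y \<Longrightarrow> h x y - (u y - u x) \<in> A"
    by blast
  \<comment> \<open>The potential \<open>u\<close> of the link becomes the value on the new edges at
    \<open>v\<close>, with the sign fixed by antisymmetry.\<close>
  define g' where "g' x y = (if x = v then (if y = v then 0 else - u y)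
    else if y = v then u x else g x y)" for x y
  have cone: "f v a b - (g' v a + g' a b + g' b v) \<in> A" if "a \<in> V" "b \<in> V" "E v a" "E a b" "E b v" for a b
  proof -
    have "h a b - (u b - u a) \<in> A"
      using that E_sym by (intro u) (auto simp: N_def)
    moreover have "a \<noteq> v" "b \<noteq> v"
      using that insert.hyps by auto
    ultimately show ?thesis
      by (simp add: h_def g'_def algebra_simps)
  qed
  show ?case
  proof (intro exI[of _ g'] conjI allI ballI impI)
    show anti': "g' a b = - g' b a" for a b
      unfolding g'_def by (cases "a = v"; cases "b = v") (simp_all, rule g_anti)
    fix a b c assume abc: "a \<in> insert v V" "b \<in> insert v V" "c \<in> insert v V" "E a b" "E b c" "E c a"
    have [simp]: "g' x x = 0" for x
      using g_zero by (simp add: g'_def)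
    have [simp]: "g' x y + g' y x = 0" for x y
      using anti'[of x y] by simp
    \<comment> \<open>As \<open>E\<close> is reflexive, triangles with repeated vertices occur too;
      on them \<open>f\<close> and the coboundary of \<open>g'\<close> both vanish.\<close>
    consider "a \<in> V" "b \<in> V" "c \<in> V" | "a = v" "b \<in> V" "c \<in> V" | "b = v" "c \<in> V" "a \<in> V"
      | "c = v" "a \<in> V" "b \<in> V" | "a = b \<or> b = c \<or> a = c"
      using abc(1-3) by auto
    then show "f a b c - (g' a b + g' b c + g' c a) \<in> A"
    proof cases
      case 1
      then have "a \<noteq> v" "b \<noteq> v" "c \<noteq> v"
        using insert.hyps by auto
      then show ?thesis
        using g[OF 1 abc(4-6)] by (simp add: g'_def)
    next
      case 2
      then show ?thesis
        using cone abc by simp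
    next
      case 3
      then show ?thesis
        using cone[of c a] abc alt(2)[of b c a] by (simp add: add_ac)
    next
      case 4
      then show ?thesis
        using cone[of a b] abc alt(2)[of a b c] by (simp add: add_ac)
    next
      case 5
      then show ?thesis
        using f_zero by (auto simp: add_ac)
    qed
  qed
qed

end

section \<open>Volumes of surfaces over a valued field\<close>

text \<open>Each directed edge lies in exactly one triangle, so the dart sets partition
  \<open>edge_rel T\<close>.\<close>

lemma sum_darts_eq_sum_edge_rel:
  fixes g :: "'v \<Rightarrow> 'v \<Rightarrow> 'a::comm_monoid_add"
  assumes "oriented_closed_surface T"
  shows "(\<Sum>(a, b, c)\<in>T. g a b + g b c + g c a) = (\<Sum>(x, y)\<in>edge_rel T. g x y)"
proof -
  have fin: "finite T"
    and distinct: "\<And>a b c. (a, b, c) \<in> T \<Longrightarrow> a \<noteq> b \<and> b \<noteq> c \<and> a \<noteq> c"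
    and unique: "\<And>x y. (x, y) \<in> edge_rel T \<Longrightarrow> \<exists>!t. t \<in> T \<and> (x, y) \<in> darts t"
    using assms unfolding oriented_closed_surface_def by auto
  have "(\<Sum>(x, y)\<in>edge_rel T. g x y) = (\<Sum>t\<in>T. \<Sum>(x, y)\<in>darts t. g x y)"
    unfolding edge_rel_def
  proof (rule sum.UNION_disjoint[OF fin])
    show "\<forall>t\<in>T. finite (darts t)"
      by (auto simp: darts_def split: prod.splits)
    show "\<forall>s\<in>T. \<forall>t\<in>T. s \<noteq> t \<longrightarrow> darts s \<inter> darts t = {}"
    proof (intro ballI impI)
      fix s t assume st: "s \<in> T" "t \<in> T" "s \<noteq> t"
      have "False" if "(x, y) \<in> darts s" "(x, y) \<in> darts t" for x y
        using unique[of x y] st that unfolding edge_rel_def by blast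
      then show "darts s \<inter> darts t = {}"
        by auto
    qed
  qed
  also have "\<dots> = (\<Sum>(a, b, c)\<in>T. g a b + g b c + g c a)"
    using distinct by (intro sum.cong) (auto simp: darts_def add.assoc)
  finally show ?thesis ..
qed

text \<open>Reversing edges permutes \<open>edge_rel T\<close>, so the sum equals its own
  negative.\<close>

lemma sum_antisym_edge_rel:
  fixes g :: "'v \<Rightarrow> 'v \<Rightarrow> 'a::field_char_0"
  assumes "oriented_closed_surface T" and anti: "\<And>x y. g x y = - g y x"
  shows "(\<Sum>(x, y)\<in>edge_rel T. g x y) = 0"
proof -
  have *: "(y, x) \<in> edge_rel T" if "(x, y) \<in> edge_rel T" for x y
  proof -
    have "\<exists>t. t \<in> T \<and> (y, x) \<in> darts t"
      using assms(1) that unfolding oriented_closed_surface_def by blast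
    then show ?thesis
      by (auto simp: edge_rel_def)
  qed
  have "(\<Sum>(x, y)\<in>edge_rel T. g x y) = (\<Sum>(x, y)\<in>edge_rel T. g y x)"
    by (rule sum.reindex_bij_witness[of _ prod.swap prod.swap]) (auto intro: *)
  also have "\<dots> = (\<Sum>(x, y)\<in>edge_rel T. - g x y)"
    by (rule sum.cong[OF refl]) (simp only: split_paired_all prod.case, rule anti)
  also have "\<dots> = - (\<Sum>(x, y)\<in>edge_rel T. g x y)"
    by (simp add: sum_negf split_def)
  finally show ?thesis
    by (simp add: eq_neg_iff_add_eq_0)
qed

text \<open>The cones from the origin over the four faces add up to the tetrahedron itself, so the
  coboundary of the determinant is translation invariant.\<close>

lemma det_boundary_tetrahedron:
  fixes p q r s :: "'a::comm_ring_1 ^ 3"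
  shows "det (vector [q, r, s] :: 'a^3^3) - det (vector [p, r, s] :: 'a^3^3)
    + det (vector [p, q, s] :: 'a^3^3) - det (vector [p, q, r] :: 'a^3^3)
    = det (vector [q - p, r - p, s - p] :: 'a^3^3)"
  by (simp add: det_3 algebra_simps)

section \<open>The graph of short distances and the volume modulo \<open>A\<close>\<close>

locale placed_vertices = valuation_subring A for A :: "'a::field_char_0 set" +
  fixes P :: "'v \<Rightarrow> 'a ^ 3"
  assumes half: "inverse 2 \<in> A"
begin

definition short :: "'v \<Rightarrow> 'v \<Rightarrow> bool" where
  "short x y \<longleftrightarrow> mform (P x - P y) (P x - P y) \<in> A"

lemma short_refl: "short x x"
  by (simp add: short_def mform_def)

lemma short_sym: "short x y \<Longrightarrow> short y x"
  by (simp add: short_def mform_diff_commute[of "P x"])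

text \<open>Polarization, with 2 a unit of \<open>A\<close>. With \<open>z\<close> as origin, edges
  in its link become scalar products in \<open>A\<close>, the form that
  \<open>no_short_chord_growth\<close> expects.\<close>

lemma short_iff_mform:
  assumes "short x z" "short y z"
  shows "short x y \<longleftrightarrow> mform (P x - P z) (P y - P z) \<in> A"
proof -
  let ?s = "mform (P x - P z) (P x - P z) + mform (P y - P z) (P y - P z)"
  have s: "?s \<in> A"
    using assms by (auto simp: short_def intro: add)
  have eq: "2 * mform (P x - P z) (P y - P z) = ?s - mform (P x - P y) (P x - P y)"
    by (rule mform_polarization)
  show ?thesis
  proof
    assume "short x y"
    then have "inverse 2 * (2 * mform (P x - P z) (P y - P z)) \<in> A"
      unfolding eq short_def using s half by (intro mult diff)
    then show "mform (P x - P z) (P y - P z) \<in> A"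
      by simp
  next
    assume "mform (P x - P z) (P y - P z) \<in> A"
    then have "?s - 2 * mform (P x - P z) (P y - P z) \<in> A"
      using s by (intro diff mult numeral)
    then show "short x y"
      unfolding eq by (simp add: short_def)
  qed
qed

sublocale graph_mod A short
  by unfold_locales (auto intro: short_refl short_sym)

text \<open>With \<open>v\<close> as origin, a walk without short chords would have ends whose
  product leaves \<open>A\<close>, against the closing edge.\<close>

lemma chorded_link: "chorded short {a \<in> V. short v a}"
  unfolding chorded_def
proof (intro allI impI)
  fix xs assume len: "3 \<le> length xs" and sub: "set xs \<subseteq> {a \<in> V. short v a}"
    and walk: "successively short xs" and closed_walk: "short (hd xs) (last xs)"
  show "\<exists>us a b c vs. xs = us @ a # b # c # vs \<and> short a c"
  proof (rule ccontr)
    assume no_chord: "\<not> ?thesis"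
    define n where "n = length xs - 1"
    define q where "q i = P (xs ! i) - P v" for i
    have n: "length xs = Suc n" "2 \<le> n"
      using len by (auto simp: n_def)
    have v: "short (xs ! i) v" if "i \<le> n" for i
      using sub nth_mem[of i xs] that n short_sym by (auto simp: subset_iff)
    have q: "mform (q i) (q j) \<in> A \<longleftrightarrow> short (xs ! i) (xs ! j)" if "i \<le> n" "j \<le> n" for i j
      unfolding q_def using short_iff_mform v that by blast
    have "mform (q 0) (q n) \<notin> A"
    proof (rule no_short_chord_growth[OF _ _ _ n(2)])
      show "mform (q i) (q i) \<in> A" if "i \<le> n" for i
        using q that short_refl by simp
      show "mform (q i) (q (Suc i)) \<in> A" if "i < n" for i
        using q[of i "Suc i"] that walk n by (simp add: successively_conv_nth)
      show "mform (q i) (q (i + 2)) \<notin> A" if i: "i + 2 \<le> n" for i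
      proof -
        have "xs = take i xs @ xs ! i # xs ! Suc i # xs ! Suc (Suc i) # drop (Suc (Suc (Suc i))) xs"
          using i n by (simp add: Cons_nth_drop_Suc)
        then have "\<not> short (xs ! i) (xs ! Suc (Suc i))"
          using no_chord by blast
        then show ?thesis
          using q[of i "i + 2"] i by simp
      qed
    qed
    moreover have "hd xs = xs ! 0" "last xs = xs ! n"
      using n by (simp_all add: hd_conv_nth last_conv_nth flip: length_greater_0_conv)
    ultimately show False
      using q[of 0 n] closed_walk by simp
  qed
qed

text \<open>The square is an integer polynomial in scalar products that lie in
  \<open>A\<close>.\<close>

lemma det_tetrahedron_mem:
  assumes "short p q" "short p r" "short p s" "short q r" "short q s" "short r s"
  shows "det (vector [P q - P p, P r - P p, P s - P p] :: 'a^3^3) \<in> A"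
proof (rule square_mem)
  have *: "mform (P x - P p) (P y - P p) \<in> A" if "short p x" "short p y" "short x y" for x y
    using short_iff_mform that short_sym by blast
  have "mform (P q - P p) (P q - P p) \<in> A" "mform (P r - P p) (P r - P p) \<in> A"
    "mform (P s - P p) (P s - P p) \<in> A" "mform (P q - P p) (P r - P p) \<in> A"
    "mform (P r - P p) (P s - P p) \<in> A" "mform (P q - P p) (P s - P p) \<in> A"
    using assms * short_refl by blast+
  then show "(det (vector [P q - P p, P r - P p, P s - P p] :: 'a^3^3))\<^sup>2 \<in> A"
    unfolding det_square_eq_gram3[OF refl refl refl refl refl refl]
    by (intro uminus add diff mult numeral power)
qed

theorem volume_mem:
  fixes T :: "('v \<times> 'v \<times> 'v) set"
  assumes surface: "oriented_closed_surface T"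
    and edges: "\<And>x y. (x, y) \<in> edge_rel T \<Longrightarrow> short x y"
  shows "(\<Sum>(a, b, c)\<in>T. det (vector [P a, P b, P c] :: 'a^3^3)) \<in> A"
proof -
  define f where "f a b c = det (vector [P a, P b, P c] :: 'a^3^3)" for a b c
  have "finite (vertices T)"
    using surface by (auto simp: oriented_closed_surface_def vertices_def tri_verts_def)
  then have "\<exists>g. (\<forall>a b. g a b = - g b a) \<and>
    (\<forall>a\<in>vertices T. \<forall>b\<in>vertices T. \<forall>c\<in>vertices T. short a b \<longrightarrow> short b c \<longrightarrow> short c a \<longrightarrow>
      f a b c - (g a b + g b c + g c a) \<in> A)"
  proof (rule two_cocycle_is_coboundary)
    show "chorded short {a \<in> vertices T. short v a}" for v
      by (rule chorded_link)
    show "f b a c = - f a b c" "f b c a = f a b c" for a b c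
      by (simp_all add: f_def det_3 algebra_simps)
    show "f b c d - f a c d + f a b d - f a b c \<in> A"
      if "short a b" "short a c" "short a d" "short b c" "short b d" "short c d" for a b c d
      unfolding f_def det_boundary_tetrahedron using that by (rule det_tetrahedron_mem)
  qed
  then obtain g where anti: "\<And>a b. g a b = - g b a"
    and g: "\<And>a b c. a \<in> vertices T \<Longrightarrow> b \<in> vertices T \<Longrightarrow> c \<in> vertices T \<Longrightarrow>
      short a b \<Longrightarrow> short b c \<Longrightarrow> short c a \<Longrightarrow> f a b c - (g a b + g b c + g c a) \<in> A"
    by blast
  have "(\<Sum>(a, b, c)\<in>T. f a b c - (g a b + g b c + g c a)) \<in> A"
  proof (rule sum, safe)
    fix a b c assume t: "(a, b, c) \<in> T"
    then have "{(a, b), (b, c), (c, a)} \<subseteq> edge_rel T" "{a, b, c} \<subseteq> vertices T"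
      by (force simp: edge_rel_def darts_def vertices_def tri_verts_def)+
    then show "f a b c - (g a b + g b c + g c a) \<in> A"
      by (intro g edges) auto
  qed
  also have "(\<Sum>(a, b, c)\<in>T. f a b c - (g a b + g b c + g c a)) =
      (\<Sum>(a, b, c)\<in>T. f a b c) - (\<Sum>(a, b, c)\<in>T. g a b + g b c + g c a)"
    by (simp add: sum_subtractf split_def)
  also have "\<dots> = (\<Sum>(a, b, c)\<in>T. f a b c)"
    unfolding sum_darts_eq_sum_edge_rel[OF surface] sum_antisym_edge_rel[OF surface anti] by simp
  finally show ?thesis
    by (simp add: f_def)
qed

end

section \<open>Formal power series and flexes\<close>

lemma subring_set_fls_const: "subring_set (range (fls_const :: 'a::field \<Rightarrow> 'a fls))"
proof
  show "1 \<in> range (fls_const :: 'a \<Rightarrow> 'a fls)"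
    by (metis fls_const_1 rangeI)
qed (auto simp: fls_minus_const)

text \<open>In Horner form, a nonzero inner value times \<open>inverse w\<close> has a pole, which
  adding a constant cannot cancel. In particular \<open>w\<close> is no polynomial in
  \<open>inverse w\<close> over the constants.\<close>

lemma fls_subdegree_poly_inverse_le_0:
  fixes w :: "'a::field fls"
  assumes "0 < fls_subdegree w" "\<forall>i. coeff p i \<in> range fls_const"
  shows "fls_subdegree (poly p (inverse w)) \<le> 0"
  using assms(2)
proof (induction p)
  case (pCons a p)
  have w: "w \<noteq> 0"
    using assms(1) by auto
  have a: "a \<in> range fls_const" and p: "\<forall>i. coeff p i \<in> range fls_const"
    using pCons.prems by (metis coeff_pCons_0, metis coeff_pCons_Suc)
  obtain c where c: "a = fls_const c"
    using a by blast
  show ?case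
  proof (cases "poly p (inverse w) = 0")
    case True
    then show ?thesis
      by (simp add: c)
  next
    case False
    then have nz: "inverse w * poly p (inverse w) \<noteq> 0"
      using w by simp
    have neg: "fls_subdegree (inverse w * poly p (inverse w)) < 0"
      using pCons.IH[OF p] assms(1) w False by simp
    then have "fls_subdegree (fls_const c + inverse w * poly p (inverse w)) < 0"
      by (subst fls_subdegree_add_eq2[OF nz]) auto
    then show ?thesis
      by (simp add: c)
  qed
qed simp

text \<open>The Zorn argument starts from the constants with \<open>inverse w\<close> adjoined, a
  ring that misses \<open>w\<close>.\<close>

lemma exists_valuation_subring_avoiding_positive_subdegree:
  fixes w :: "'a::field fls"
  assumes "0 < fls_subdegree w"
  obtains B where "valuation_subring B" "range fls_const \<subseteq> B" "w \<notin> B"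
proof -
  interpret C: subring_set "range (fls_const :: 'a \<Rightarrow> 'a fls)"
    by (rule subring_set_fls_const)
  interpret D: subring_set "adjoin (range fls_const) (inverse w)"
    by (rule C.subring_set_adjoin)
  have "w \<notin> adjoin (range fls_const) (inverse w)"
    using fls_subdegree_poly_inverse_le_0[OF assms] assms unfolding adjoin_def by fastforce
  then have "inverse (inverse w) \<notin> adjoin (range fls_const) (inverse w)"
    by simp
  from D.exists_valuation_subring_avoiding[OF C.in_adjoin this] obtain B
    where "valuation_subring B" "adjoin (range fls_const) (inverse w) \<subseteq> B" "w \<notin> B"
    by auto
  then show ?thesis
    using that C.subset_adjoin by blast
qed

lemma fps_to_fls_sum: "fps_to_fls (\<Sum>i\<in>I. f i) = (\<Sum>i\<in>I. fps_to_fls (f i))"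
  by (induction I rule: infinite_finite_induct) auto

theorem formal_volume_constant:
  fixes T :: "('v \<times> 'v \<times> 'v) set" and F :: "'v \<Rightarrow> 'a::field_char_0 fps ^ 3"
  assumes surface: "oriented_closed_surface T"
    and edges: "\<And>x y. (x, y) \<in> edge_rel T \<Longrightarrow> \<exists>c. mform (F x - F y) (F x - F y) = fps_const c"
  shows "\<exists>c. (\<Sum>(x, y, z)\<in>T. det (vector [F x, F y, F z] :: 'a fps^3^3)) = fps_const c"
proof (rule ccontr)
  assume nonconst: "\<not> ?thesis"
  define V where "V = (\<Sum>(x, y, z)\<in>T. det (vector [F x, F y, F z] :: 'a fps^3^3))"
  \<comment> \<open>Removing the constant term gives \<open>w\<close> positive order; membership of
    \<open>V\<close> in a ring containing the constants is unaffected.\<close>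
  define w where "w = V - fps_const (fps_nth V 0)"
  define P where "P v = (\<chi> i. fps_to_fls (F v $ i))" for v
  have "w \<noteq> 0" "fps_nth w 0 = 0"
    using nonconst by (auto simp: w_def V_def)
  then have "0 < subdegree w"
    by (metis gr0I nth_subdegree_nonzero)
  then have "0 < fls_subdegree (fps_to_fls w)"
    by (simp add: fls_subdegree_fls_to_fps)
  then obtain B where B: "valuation_subring B" "range fls_const \<subseteq> B" "fps_to_fls w \<notin> B"
    by (rule exists_valuation_subring_avoiding_positive_subdegree)
  have "inverse 2 = fls_const (inverse (2::'a))"
    by (metis fls_const_numeral fls_inverse_const)
  then have half: "inverse 2 \<in> B"
    using B(2) by auto
  interpret placed_vertices B P
    using B(1) half by (simp add: placed_vertices_def placed_vertices_axioms_def)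
  have "(\<Sum>(x, y, z)\<in>T. det (vector [P x, P y, P z] :: 'a fls^3^3)) \<in> B"
  proof (rule volume_mem[OF surface])
    fix x y assume "(x, y) \<in> edge_rel T"
    then obtain c where c: "mform (F x - F y) (F x - F y) = fps_const c"
      using edges by blast
    have "mform (P x - P y) (P x - P y) = fps_to_fls (mform (F x - F y) (F x - F y))"
      by (simp add: mform_def P_def fls_times_fps_to_fls)
    then show "short x y"
      unfolding short_def c using B(2) by auto
  qed
  also have "(\<Sum>(x, y, z)\<in>T. det (vector [P x, P y, P z] :: 'a fls^3^3)) = fps_to_fls V"
    by (simp add: V_def fps_to_fls_sum split_def det_3 P_def fls_times_fps_to_fls)
  finally have "fps_to_fls V - fls_const (fps_nth V 0) \<in> B"
    using B(2) by (intro diff) auto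
  then show False
    using B(3) by (simp add: w_def)
qed

section \<open>From analytic flexes to formal power series and back\<close>

lemma has_fps_expansion_unique_zero:
  fixes f :: "real \<Rightarrow> real"
  assumes f: "f has_fps_expansion F" and zeros: "\<exists>\<^sub>F x in at 0. f x = 0"
  shows "F = 0"
proof (rule ccontr)
  assume "F \<noteq> 0"
  define n where "n = subdegree F"
  \<comment> \<open>Dividing out the leading power leaves a function with nonzero limit at 0, so
    zeros of \<open>f\<close> could not accumulate there.\<close>
  define g where "g x = (if x = 0 then fps_nth F n else f x / x ^ n)" for x
  have "g has_fps_expansion fps_shift n F"
    unfolding g_def by (rule has_fps_expansion_shift[OF f]) (auto simp: n_def)
  then have "continuous (at 0 within UNIV) g"
    by (rule has_fps_expansion_imp_continuous)
  then have "g \<midarrow>0\<rightarrow> fps_nth F n"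
    by (simp add: continuous_within g_def)
  moreover have "fps_nth F n \<noteq> 0"
    using \<open>F \<noteq> 0\<close> by (simp add: n_def)
  ultimately have "\<forall>\<^sub>F x in at 0. g x \<noteq> 0"
    by (rule tendsto_imp_eventually_ne)
  moreover have "\<forall>\<^sub>F x in at (0::real). x \<noteq> 0"
    by (simp add: eventually_at_filter)
  ultimately have "\<forall>\<^sub>F x in at 0. f x \<noteq> 0"
    by eventually_elim (auto simp: g_def)
  then show False
    using zeros by (simp add: frequently_def)
qed

text \<open>At the endpoints only one side of \<open>t\<close> is available, so identities along the
  flex hold frequently, not eventually, near 0.\<close>

lemma frequently_unit_interval:
  fixes t :: real
  assumes "t \<in> {0..1}"
  shows "\<exists>\<^sub>F s in at 0. t + s \<in> {0..1}"
proof -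
  have "t islimpt {0..1}"
    using assms by (simp add: islimpt_Icc)
  then have "\<exists>\<^sub>F y in at t. y \<in> {0..1}"
    by (simp add: islimpt_iff_eventually frequently_def)
  then show ?thesis
    unfolding at_to_0[of t] frequently_def eventually_filtermap by (simp add: add.commute)
qed

lemma real_analytic_on_imp_fps:
  assumes f: "real_analytic_on f {0..1}" and t: "t \<in> {0..1}"
  shows "\<exists>F. 0 < fps_conv_radius F \<and> (\<forall>\<^sub>F y in nhds t. y \<in> {0..1} \<longrightarrow> f y = eval_fps F (y - t))"
proof -
  obtain r c where r: "0 < r"
    and c: "\<And>y. y \<in> {0..1} \<Longrightarrow> \<bar>y - t\<bar> < r \<Longrightarrow> (\<lambda>n. c n * (y - t) ^ n) sums f y"
    using f t unfolding real_analytic_on_def by blast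
  define d where "d = min (r / 2) (1 / 2)"
  \<comment> \<open>A step of at most one half towards the farther endpoint stays in the interval;
    convergence at this point other than \<open>t\<close> makes the radius positive.\<close>
  define y where "y = (if t \<le> 1 / 2 then t + d else t - d)"
  have "y \<in> {0..1}" "\<bar>y - t\<bar> < r" "0 < \<bar>y - t\<bar>"
    using t r by (auto simp: y_def d_def min_def)
  then have "ereal (norm (y - t)) \<le> conv_radius c" "0 < ereal (norm (y - t))"
    using conv_radius_geI[OF sums_summable[OF c[of y]]] by simp_all
  from this(2,1) have "0 < conv_radius c"
    by (rule less_le_trans)
  then have "0 < fps_conv_radius (Abs_fps c)"
    by (simp add: fps_conv_radius_def)
  moreover have "\<forall>\<^sub>F y in nhds t. \<bar>y - t\<bar> < r"
    using eventually_nhds_ball[OF r, of t] by (simp add: dist_real_def abs_minus_commute)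
  then have "\<forall>\<^sub>F y in nhds t. y \<in> {0..1} \<longrightarrow> f y = eval_fps (Abs_fps c) (y - t)"
    by eventually_elim (use c in \<open>auto simp: eval_fps_def intro!: sums_unique\<close>)
  ultimately show ?thesis
    by blast
qed

lemma mlength_eq_imp_mink_eq: "mlength x = mlength y \<Longrightarrow> mink x x = mink y y"
  unfolding mlength_def by (metis of_real_eq_iff power2_csqrt)

lemma mink_eq_mform: "mink = mform"
  by (simp add: fun_eq_iff mink_def mform_def)

text \<open>The Taylor series of the vertices at \<open>t\<close> satisfy the edge equations as
  formal identities, so the formal theorem makes the series of the volume constant.\<close>

lemma gen_vol_locally_constant:
  fixes T :: "('v \<times> 'v \<times> 'v) set" and P :: "real \<Rightarrow> 'v \<Rightarrow> real^3"
  assumes surface: "oriented_closed_surface T" and flex: "nontrivial_flex T P"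
    and t: "t \<in> {0..1}"
  shows "\<forall>\<^sub>F y in nhds t. y \<in> {0..1} \<longrightarrow> gen_vol T (P y) = gen_vol T (P t)"
proof -
  have nhds_t: "nhds t = filtermap (\<lambda>s. s + t) (nhds 0)"
    using filtermap_nhds_shift[of "- t" 0] by simp
  define expands where "expands v i F \<longleftrightarrow> 0 < fps_conv_radius F \<and>
      (\<forall>\<^sub>F y in nhds t. y \<in> {0..1} \<longrightarrow> P y v $ i = eval_fps F (y - t))" for v i F
  define \<phi> where "\<phi> v i = (SOME F. expands v i F)" for v i
  have "expands v i (\<phi> v i)" if "v \<in> vertices T" for v i
  proof -
    have "real_analytic_on (\<lambda>t. P t v $ i) {0..1}"
      using flex that by (simp add: nontrivial_flex_def)
    from real_analytic_on_imp_fps[OF this t] show ?thesis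
      unfolding \<phi>_def by (intro someI_ex[of "expands v i"]) (simp add: expands_def)
  qed
  then have \<phi>: "\<And>v i. v \<in> vertices T \<Longrightarrow> 0 < fps_conv_radius (\<phi> v i)"
      "\<And>v i. v \<in> vertices T \<Longrightarrow> \<forall>\<^sub>F y in nhds t. y \<in> {0..1} \<longrightarrow> P y v $ i = eval_fps (\<phi> v i) (y - t)"
    by (simp_all add: expands_def)
  define F where "F v = (\<chi> i. \<phi> v i)" for v
  \<comment> \<open>The sums of the series extend the flex to both sides of \<open>t\<close>, even
    at an endpoint; they agree with \<open>P\<close> only inside the interval.\<close>
  define g where "g s v = (\<chi> i. eval_fps (\<phi> v i) s)" for s v
  have g_exp: "(\<lambda>s. g s v $ i) has_fps_expansion F v $ i" if "v \<in> vertices T" for v i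
    using \<phi>(1)[OF that] by (simp add: g_def F_def eval_fps_has_fps_expansion)
  have "finite (vertices T)"
    using surface by (auto simp: oriented_closed_surface_def vertices_def tri_verts_def)
  then have "\<forall>\<^sub>F y in nhds t. \<forall>v\<in>vertices T. \<forall>i\<in>UNIV. y \<in> {0..1} \<longrightarrow> P y v $ i = eval_fps (\<phi> v i) (y - t)"
    using \<phi>(2) by (intro eventually_ball_finite ballI) auto
  then have P_eq: "\<forall>\<^sub>F y in nhds t. y \<in> {0..1} \<longrightarrow> (\<forall>v\<in>vertices T. P y v = g (y - t) v)"
    by eventually_elim (auto simp: vec_eq_iff g_def)
  then have P_eq0: "\<forall>\<^sub>F s in nhds 0. t + s \<in> {0..1} \<longrightarrow> (\<forall>v\<in>vertices T. P (t + s) v = g s v)"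
    unfolding nhds_t eventually_filtermap by (simp add: add.commute)
  have tri: "a \<in> vertices T" "b \<in> vertices T" "c \<in> vertices T" if "(a, b, c) \<in> T" for a b c
    using that by (force simp: vertices_def tri_verts_def)+
  have "\<exists>c. mform (F x - F y) (F x - F y) = fps_const c" if xy: "(x, y) \<in> edge_rel T" for x y
  proof -
    have v: "x \<in> vertices T" "y \<in> vertices T"
      using xy by (force simp: edge_rel_def darts_def vertices_def tri_verts_def)+
    define c where "c = mform (P 0 x - P 0 y) (P 0 x - P 0 y)"
    have len: "mform (P s x - P s y) (P s x - P s y) = c" if "s \<in> {0..1}" for s
    proof -
      have "\<forall>(v, w)\<in>edge_rel T. \<forall>t\<in>{0..1}. mlength (P t v - P t w) = mlength (P 0 v - P 0 w)"
        using flex unfolding nontrivial_flex_def by (elim conjE)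
      from bspec[OF bspec[OF this xy, unfolded prod.case] that]
      have "mlength (P s x - P s y) = mlength (P 0 x - P 0 y)" .
      then show ?thesis
        unfolding c_def mink_eq_mform[symmetric] by (rule mlength_eq_imp_mink_eq)
    qed
    have "(\<lambda>s. mform (g s x - g s y) (g s x - g s y) - c) has_fps_expansion
        mform (F x - F y) (F x - F y) - fps_const c"
      unfolding mform_def vector_minus_component
      by (intro has_fps_expansion_diff has_fps_expansion_add has_fps_expansion_mult
          has_fps_expansion_const g_exp v)
    moreover have "\<forall>\<^sub>F s in at 0. t + s \<in> {0..1} \<longrightarrow> (\<forall>v\<in>vertices T. P (t + s) v = g s v)"
      using P_eq0 by (rule filter_leD[OF at_within_le_nhds])
    then have "\<forall>\<^sub>F s in at 0. t + s \<in> {0..1} \<longrightarrow> mform (g s x - g s y) (g s x - g s y) - c = 0"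
    proof eventually_elim
      case (elim s)
      show ?case
      proof
        assume s: "t + s \<in> {0..1}"
        then have "P (t + s) x = g s x" "P (t + s) y = g s y"
          using elim v by blast+
        then show "mform (g s x - g s y) (g s x - g s y) - c = 0"
          using len[OF s] by simp
      qed
    qed
    \<comment> \<open>Edge lengths are known to be constant only for parameters in the interval, but
      these accumulate at \<open>t\<close>, which forces the formal identity.\<close>
    then have "\<exists>\<^sub>F s in at 0. mform (g s x - g s y) (g s x - g s y) - c = 0"
      by (rule frequently_rev_mp[OF frequently_unit_interval[OF t]])
    ultimately have "mform (F x - F y) (F x - F y) - fps_const c = 0"
      by (rule has_fps_expansion_unique_zero)
    then show ?thesis
      by auto
  qed
  from formal_volume_constant[where F = F, OF surface this] obtain c
    where c: "(\<Sum>(x, y, z)\<in>T. det (vector [F x, F y, F z] :: real fps^3^3)) = fps_const c"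
    by blast
  have "(\<lambda>s. \<Sum>(x, y, z)\<in>T. det (vector [g s x, g s y, g s z] :: real^3^3)) has_fps_expansion
      (\<Sum>(x, y, z)\<in>T. det (vector [F x, F y, F z] :: real fps^3^3))"
  proof (rule has_fps_expansion_sum)
    fix p assume p: "p \<in> T"
    obtain x y z where xyz: "p = (x, y, z)"
      by (cases p)
    note v = tri[OF p[unfolded xyz]]
    show "(\<lambda>s. case p of (x, y, z) \<Rightarrow> det (vector [g s x, g s y, g s z] :: real^3^3)) has_fps_expansion
        (case p of (x, y, z) \<Rightarrow> det (vector [F x, F y, F z] :: real fps^3^3))"
      unfolding xyz prod.case det_3 vector_3
      by (intro has_fps_expansion_diff has_fps_expansion_add has_fps_expansion_mult g_exp v)
  qed
  then have "\<forall>\<^sub>F s in nhds 0. (\<Sum>(x, y, z)\<in>T. det (vector [g s x, g s y, g s z] :: real^3^3)) = c"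
    unfolding c has_fps_expansion_def by (auto elim: eventually_mono)
  then have "\<forall>\<^sub>F y in nhds t. (\<Sum>(a, b, d)\<in>T. det (vector [g (y - t) a, g (y - t) b, g (y - t) d] :: real^3^3)) = c"
    unfolding nhds_t eventually_filtermap by simp
  with P_eq have vol: "\<forall>\<^sub>F y in nhds t. y \<in> {0..1} \<longrightarrow> gen_vol T (P y) = 1 / 6 * c"
  proof eventually_elim
    case (elim y)
    show ?case
    proof
      assume "y \<in> {0..1}"
      then have "(\<Sum>(a, b, d)\<in>T. det (vector [P y a, P y b, P y d] :: real^3^3)) = c"
        unfolding elim(2)[symmetric] using elim(1) tri by (intro sum.cong) auto
      then show "gen_vol T (P y) = 1 / 6 * c"
        by (simp add: gen_vol_def)
    qed
  qed
  then have "gen_vol T (P t) = 1 / 6 * c"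
    using t by (auto dest: eventually_nhds_x_imp_x)
  from vol[folded this] show ?thesis .
qed

theorem theorem2:
  fixes T :: "('v \<times> 'v \<times> 'v) set" and P :: "real \<Rightarrow> 'v \<Rightarrow> real^3"
  assumes "oriented_closed_surface T"
    and "nontrivial_flex T P"
  shows "\<forall>t\<in>{0..1}. gen_vol T (P t) = gen_vol T (P 0)"
proof
  fix t :: real assume "t \<in> {0..1}"
  show "gen_vol T (P t) = gen_vol T (P 0)"
  proof (rule connected_local_const[where A = "{0..1::real}" and f = "\<lambda>t. gen_vol T (P t)"])
    show "\<forall>a\<in>{0..1}. \<forall>\<^sub>F b in at a within {0..1}. gen_vol T (P a) = gen_vol T (P b)"
    proof
      fix a :: real assume "a \<in> {0..1}"
      from gen_vol_locally_constant[OF assms this]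
      show "\<forall>\<^sub>F b in at a within {0..1}. gen_vol T (P a) = gen_vol T (P b)"
        unfolding eventually_at_filter by eventually_elim auto
    qed
  qed (use \<open>t \<in> {0..1}\<close> in auto)
qed

end
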